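(* Let $(T,\cdot,[-,-])$ be a nonzero $2$-dimensional transposed Leibniz--Poisson algebra over $\mathbb C$. Then $T$ is isomorphic to one of the following algebras with basis $e_1,e_2$ (where $\alpha\in\mathbb C$). (a) Algebras with zero product $\cdot$: $T_1: [e_1,e_1]=e_2$; $T_2: [e_1,e_2]=e_2,\ [e_2,e_1]=-e_2$. (b) Algebras with nonzero product $\cdot$: $T_3: e_1\cdot e_1=e_1,\ e_2\cdot e_2=e_2$; $T_4: e_1\cdot e_1=e_1,\ e_1\cdot e_2=e_2,\ [e_1,e_1]=e_2$; $T_5^{\alpha}: e_1\cdot e_1=e_1,\ e_1\cdot e_2=e_2,\ [e_1,e_2]=\alpha e_2,\ [e_2,e_1]=-\alpha e_2$; $T_6: e_1\cdot e_1=e_1$; $T_7^{\alpha}: e_1\cdot e_1=e_2,\ [e_1,e_1]=\alpha e_2$; $T_8: e_1\cdot e_1=e_2,\ [e_1,e_2]=e_2,\ [e_2,e_1]=-e_2$.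
   Context: A transposed Leibniz--Poisson algebra is a complex vector space with a commutative associative product $\cdot$ and a symmetric Leibniz bracket $[-,-]$, i.e. a bilinear bracket satisfying both $[[x,y],z]=[[x,z],y]+[x,[y,z]]$ and $[x,[y,z]]=[[x,y],z]+[y,[x,z]]$, such that $2[x,y]\cdot z=[x\cdot z,y]+[x,y\cdot z]$. It is nonzero if the two products are not both zero. Isomorphisms are linear bijections preserving both products. In multiplication tables, products of basis elements not listed are zero, except that $e_2\cdot e_1=e_1\cdot e_2$ by commutativity of $\cdot$. *)

theory Defs
  imports "HOL-Analysis.Cartesian_Space"
begin

locale complex_bilinear = vector_space scale
  for scale :: "complex \<Rightarrow> 'a::ab_group_add \<Rightarrow> 'a" +
  fixes p :: "'a \<Rightarrow> 'a \<Rightarrow> 'a"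
  assumes linear_left: "\<And>y. Vector_Spaces.linear scale scale (\<lambda>x. p x y)"
    and linear_right: "\<And>x. Vector_Spaces.linear scale scale (\<lambda>y. p x y)"

locale symmetric_leibniz = complex_bilinear scale br
  for scale :: "complex \<Rightarrow> 'a::ab_group_add \<Rightarrow> 'a" and br :: "'a \<Rightarrow> 'a \<Rightarrow> 'a" +
  assumes right_leibniz: "\<And>x y z. br (br x y) z = br (br x z) y + br x (br y z)"
    and left_leibniz: "\<And>x y z. br x (br y z) = br (br x y) z + br y (br x z)"

locale transposed_leibniz_poisson =
  complex_bilinear scale mul + symmetric_leibniz scale br
  for scale :: "complex \<Rightarrow> 'a::ab_group_add \<Rightarrow> 'a"
    and mul :: "'a \<Rightarrow> 'a \<Rightarrow> 'a" and br :: "'a \<Rightarrow> 'a \<Rightarrow> 'a" +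
  assumes mul_commute: "\<And>x y. mul x y = mul y x"
    and mul_assoc: "\<And>x y z. mul (mul x y) z = mul x (mul y z)"
    and transposed_leibniz:
      "\<And>x y z. scale 2 (mul (br x y) z) = br (mul x z) y + br x (mul y z)"

text \<open>A pair consists of the product and the bracket, in this order.\<close>

type_synonym 'a two_products = "('a \<Rightarrow> 'a \<Rightarrow> 'a) \<times> ('a \<Rightarrow> 'a \<Rightarrow> 'a)"

definition isomorphic_algebras ::
  "(complex \<Rightarrow> 'a::ab_group_add \<Rightarrow> 'a) \<Rightarrow> 'a two_products \<Rightarrow>
   (complex \<Rightarrow> 'b::ab_group_add \<Rightarrow> 'b) \<Rightarrow> 'b two_products \<Rightarrow> bool" where
  "isomorphic_algebras scaleA A scaleB B \<longleftrightarrow>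
    (\<exists>f. Vector_Spaces.linear scaleA scaleB f \<and> bij f \<and>
         (\<forall>x y. f (fst A x y) = fst B (f x) (f y)) \<and>
         (\<forall>x y. f (snd A x y) = snd B (f x) (f y)))"

definition e1 :: "complex ^ 2" where "e1 = axis 1 1"

definition e2 :: "complex ^ 2" where "e2 = axis 2 1"

text \<open>The bilinear product with
  \<open>e1 e1 = a11\<close>, \<open>e1 e2 = a12\<close>, \<open>e2 e1 = a21\<close>, \<open>e2 e2 = a22\<close>.\<close>

definition table ::
  "complex ^ 2 \<Rightarrow> complex ^ 2 \<Rightarrow> complex ^ 2 \<Rightarrow> complex ^ 2 \<Rightarrow>
   complex ^ 2 \<Rightarrow> complex ^ 2 \<Rightarrow> complex ^ 2" where
  "table a11 a12 a21 a22 x y =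
    (x $ 1 * y $ 1) *s a11 + (x $ 1 * y $ 2) *s a12 +
    (x $ 2 * y $ 1) *s a21 + (x $ 2 * y $ 2) *s a22"

definition T1 :: "(complex ^ 2) two_products" where
  "T1 = (table 0 0 0 0, table e2 0 0 0)"

definition T2 :: "(complex ^ 2) two_products" where
  "T2 = (table 0 0 0 0, table 0 e2 (- e2) 0)"

definition T3 :: "(complex ^ 2) two_products" where
  "T3 = (table e1 0 0 e2, table 0 0 0 0)"

definition T4 :: "(complex ^ 2) two_products" where
  "T4 = (table e1 e2 e2 0, table e2 0 0 0)"

definition T5 :: "complex \<Rightarrow> (complex ^ 2) two_products" where
  "T5 \<alpha> = (table e1 e2 e2 0, table 0 (\<alpha> *s e2) (- (\<alpha> *s e2)) 0)"

definition T6 :: "(complex ^ 2) two_products" where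
  "T6 = (table e1 0 0 0, table 0 0 0 0)"

definition T7 :: "complex \<Rightarrow> (complex ^ 2) two_products" where
  "T7 \<alpha> = (table e2 0 0 0, table (\<alpha> *s e2) 0 0 0)"

definition T8 :: "(complex ^ 2) two_products" where
  "T8 = (table e2 0 0 0, table 0 e2 (- e2) 0)"

end

theory Submission
  imports Defs
begin

text \<open>
  If the product is nonzero, then there is either a nonzero idempotent, or a vector \<open>x\<close> such that
  \<open>x, x\<^sup>2\<close> is a basis and \<open>x\<^sup>3 = 0\<close>. In the first case the Peirce decomposition of the idempotent
  yields a basis in which the product is that of \<open>T3\<close>, of \<open>T4\<close> and \<open>T5\<close>, or of \<open>T6\<close>.
  For a fixed product the transposed Leibniz rule is linear in the bracket. It leaves a bracket with
  few parameters, and the consequence \<open>[x,[x,x]] = 0\<close> of the Leibniz rules does the rest.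
  If the product is zero, either the bracket is alternating, and then its values are multiples of a
  single vector \<open>v\<close>, on which some \<open>[u,-]\<close> acts as the identity, or some \<open>[x,x]\<close> is nonzero, and
  then \<open>x, [x,x]\<close> is a basis and \<open>[x,x]\<close> brackets to zero with everything.
\<close>

section \<open>Ordered bases of a two-dimensional space\<close>

locale plane = vector_space +
  assumes dim_2: "dim UNIV = 2"
begin

text \<open>Order and explicit coordinates matter here: tables depend on the order, and most
  arguments compare coefficients.\<close>

definition basis_pair :: "'b \<Rightarrow> 'b \<Rightarrow> bool" where
  "basis_pair u v \<longleftrightarrow> (\<forall>p q. scale p u + scale q v = 0 \<longrightarrow> p = 0 \<and> q = 0) \<and>
     (\<forall>w. \<exists>p q. w = scale p u + scale q v)"

lemma basis_pair_coeffs_0: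
  "basis_pair u v \<Longrightarrow> scale p u + scale q v = 0 \<Longrightarrow> p = 0 \<and> q = 0"
  unfolding basis_pair_def by blast

lemma basis_pair_coords:
  assumes "basis_pair u v"
  obtains p q where "w = scale p u + scale q v"
  using assms unfolding basis_pair_def by blast

lemma basis_pair_coeffs_eq:
  assumes "basis_pair u v" and "scale p u + scale q v = scale p' u + scale q' v"
  shows "p = p' \<and> q = q'"
proof -
  have "scale (p - p') u + scale (q - q') v = 0"
    using assms(2) by (simp add: scale_left_diff_distrib algebra_simps)
  from basis_pair_coeffs_0[OF assms(1) this] show ?thesis by simp
qed

lemma basis_pair_nonzero:
  assumes "basis_pair u v"
  shows "u \<noteq> 0" "v \<noteq> 0"
  using basis_pair_coeffs_0[OF assms, of 1 0] basis_pair_coeffs_0[OF assms, of 0 1] by auto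

text \<open>Two independent vectors span a plane, so a new pair only has to be tested for
  independence.\<close>

lemma basis_pairI:
  assumes ind: "\<And>p q. scale p u + scale q v = 0 \<Longrightarrow> p = 0 \<and> q = 0"
  shows "basis_pair u v"
proof -
  obtain B where B: "independent B" "span B = UNIV" "card B = 2"
    using basis_exists[of UNIV] dim_2 by (metis UNIV_I UNIV_eq_I subset_iff)
  \<comment> \<open>Infinite sets have \<open>card\<close> 0, so \<open>card B = 2\<close> makes
    \<open>B\<close> finite, as the dimension count for \<open>{u, v}\<close> requires.\<close>
  then interpret fin: finite_dimensional_vector_space scale B
    by unfold_locales (auto intro: card_ge_0_finite)
  have "u \<noteq> v" using ind[of 1 "-1"] by auto
  have v0: "v \<noteq> 0" using ind[of 0 1] by auto
  have "u \<noteq> scale k v" for k using ind[of 1 "-k"] by auto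
  then have "independent {u, v}"
    using v0 \<open>u \<noteq> v\<close> by (auto simp: independent_insert span_singleton)
  then have span: "span {u, v} = UNIV"
    using fin.card_ge_dim_independent[of "{u, v}" UNIV] \<open>u \<noteq> v\<close> dim_2 by auto
  have "\<exists>p q. w = scale p u + scale q v" for w
  proof -
    have "w \<in> span {u, v}" using span by simp
    then obtain p where "w - scale p u \<in> span {v}" by (auto simp: span_insert)
    then obtain q where "w - scale p u = scale q v" by (auto simp: span_singleton)
    then have "w = scale p u + scale q v" by (simp add: algebra_simps)
    then show ?thesis by blast
  qed
  then show ?thesis using ind unfolding basis_pair_def by blast
qed

lemma basis_pair_noncollinear:
  assumes "u \<noteq> 0" and "\<And>c. v \<noteq> scale c u"
  shows "basis_pair u v"
proof (rule basis_pairI)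
  fix p q assume eq: "scale p u + scale q v = 0"
  have "q = 0"
  proof (rule ccontr)
    assume "q \<noteq> 0"
    have "scale q v = scale (- p) u" using eq by (simp add: eq_neg_iff_add_eq_0 add.commute)
    then have "scale (1 / q) (scale q v) = scale (1 / q) (scale (- p) u)" by simp
    then have "v = scale (- p / q) u" using \<open>q \<noteq> 0\<close> by simp
    then show False using assms(2) by blast
  qed
  then show "p = 0 \<and> q = 0" using eq assms(1) by simp
qed

lemma basis_pair_extend:
  assumes "u \<noteq> 0"
  obtains v where "basis_pair u v"
proof -
  have "\<exists>v. \<forall>c. v \<noteq> scale c u"
  proof (rule ccontr)
    assume "\<not> ?thesis"
    then have "UNIV \<subseteq> span {u}" by (auto simp: span_singleton)
    then have "dim UNIV \<le> card {u}" by (rule dim_le_card) simp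
    then show False using dim_2 by simp
  qed
  then show thesis using basis_pair_noncollinear[OF assms] that by blast
qed

lemma basis_pair_scale:
  assumes "basis_pair u v" and "a \<noteq> 0" and "b \<noteq> 0"
  shows "basis_pair (scale a u) (scale b v)"
proof (rule basis_pairI)
  fix p q assume "scale p (scale a u) + scale q (scale b v) = 0"
  then show "p = 0 \<and> q = 0"
    using basis_pair_coeffs_0[OF assms(1), of "p * a" "q * b"] assms(2,3) by simp
qed

lemma basis_pair_shear:
  assumes "basis_pair u v"
  shows "basis_pair u (v - scale a u)"
proof (rule basis_pairI)
  fix p q assume "scale p u + scale q (v - scale a u) = 0"
  then have "scale (p - q * a) u + scale q v = 0" by (simp add: algebra_simps)
  from basis_pair_coeffs_0[OF assms this] show "p = 0 \<and> q = 0" by simp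
qed

end

section \<open>Recognizing an algebra from its multiplication table\<close>

lemma (in complex_bilinear) bilinear_simps:
  "p (x + y) z = p x z + p y z" "p x (y + z) = p x y + p x z"
  "p (scale c x) y = scale c (p x y)" "p x (scale c y) = scale c (p x y)"
  "p 0 x = 0" "p x 0 = 0"
  "p (- x) y = - p x y" "p x (- y) = - p x y"
  "p (x - y) z = p x z - p y z" "p x (y - z) = p x y - p x z"
proof -
  interpret l: Vector_Spaces.linear scale scale "\<lambda>x. p x y" for y by (rule linear_left)
  interpret r: Vector_Spaces.linear scale scale "p x" for x by (rule linear_right)
  show
    "p (x + y) z = p x z + p y z" "p x (y + z) = p x y + p x z"
    "p (scale c x) y = scale c (p x y)" "p x (scale c y) = scale c (p x y)"
    "p 0 x = 0" "p x 0 = 0"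
    "p (- x) y = - p x y" "p x (- y) = - p x y"
    "p (x - y) z = p x z - p y z" "p x (y - z) = p x y - p x z"
    by (fact l.add r.add l.scale r.scale l.zero r.zero l.neg r.neg l.diff r.diff)+
qed

locale transposed_leibniz_poisson_plane = plane scale + transposed_leibniz_poisson scale mul br
  for scale :: "complex \<Rightarrow> 'a::ab_group_add \<Rightarrow> 'a" and mul br :: "'a \<Rightarrow> 'a \<Rightarrow> 'a"
begin

lemma complex_bilinear_mul: "complex_bilinear scale mul"
  and complex_bilinear_br: "complex_bilinear scale br"
  using transposed_leibniz_poisson_axioms
  unfolding transposed_leibniz_poisson_def symmetric_leibniz_def by auto

lemmas mul_simps = complex_bilinear.bilinear_simps[OF complex_bilinear_mul]
lemmas br_simps = complex_bilinear.bilinear_simps[OF complex_bilinear_br]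

text \<open>For a basis \<open>u, v\<close> its inverse is the coordinate map, which serves as the
  isomorphism in \<open>isomorphic_tableI\<close>.\<close>

definition comb :: "'a \<Rightarrow> 'a \<Rightarrow> complex ^ 2 \<Rightarrow> 'a" where
  "comb u v x = scale (x $ 1) u + scale (x $ 2) v"

lemma comb_simps [simp]:
  "comb u v 0 = 0" "comb u v e1 = u" "comb u v e2 = v"
  "comb u v (- x) = - comb u v x" "comb u v (c *s x) = scale c (comb u v x)"
  by (simp_all add: comb_def e1_def e2_def axis_def algebra_simps)

lemma comb_add: "comb u v (x + y) = comb u v x + comb u v y"
  by (simp add: comb_def algebra_simps)

text \<open>Bilinear products are determined by their values on a basis, so \<open>comb u v\<close>
  carries the tables to \<open>mul\<close> and \<open>br\<close>. Commutativity supplies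
  \<open>mul v u\<close>.\<close>

lemma isomorphic_tableI:
  assumes b: "basis_pair u v"
    and m: "mul u u = comb u v a11" "mul u v = comb u v a12" "mul v v = comb u v a22"
    and r: "br u u = comb u v c11" "br u v = comb u v c12"
      "br v u = comb u v c21" "br v v = comb u v c22"
  shows "isomorphic_algebras scale (mul, br) (*s)
    (table a11 a12 a12 a22, table c11 c12 c21 c22)"
proof -
  let ?g = "comb u v"
  have "bij ?g"
  proof (rule bijI)
    show "inj ?g"
      by (rule injI) (use basis_pair_coeffs_eq[OF b] in \<open>simp add: comb_def vec_eq_iff forall_2\<close>)
    have "\<exists>x. w = ?g x" for w
    proof -
      obtain p q where "w = scale p u + scale q v" using basis_pair_coords[OF b] .
      then have "w = ?g (\<chi> i. if i = 1 then p else q)" by (simp add: comb_def)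
      then show ?thesis by blast
    qed
    then show "surj ?g" by (auto simp: surj_def)
  qed
  define f where "f = inv ?g"
  have fg: "f (?g x) = x" for x unfolding f_def using \<open>bij ?g\<close> by (simp add: bij_is_inj)
  have gf: "?g (f w) = w" for w
    unfolding f_def using \<open>bij ?g\<close> by (simp add: bij_is_surj surj_f_inv_f)
  have "mul v u = comb u v a12" using m(2) by (simp add: mul_commute)
  then have gm: "mul (?g x) (?g y) = ?g (table a11 a12 a12 a22 x y)" for x y
    unfolding table_def comb_add comb_simps m[symmetric]
    by (simp add: comb_def[of u v x] comb_def[of u v y] mul_simps m algebra_simps)
  have gr: "br (?g x) (?g y) = ?g (table c11 c12 c21 c22 x y)" for x y
    unfolding table_def comb_add comb_simps r[symmetric]
    by (simp add: comb_def[of u v x] comb_def[of u v y] br_simps r algebra_simps)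
  have "Vector_Spaces.linear scale (*s) f"
  proof
    fix x y :: 'a and c :: complex
    show "f (x + y) = f x + f y" by (metis comb_add fg gf)
    show "f (scale c x) = c *s f x" by (metis comb_simps(5) fg gf)
  qed
  moreover have "bij f" unfolding f_def using \<open>bij ?g\<close> by (rule bij_imp_bij_inv)
  moreover have "f (mul x y) = table a11 a12 a12 a22 (f x) (f y)" for x y
    by (metis fg gf gm)
  moreover have "f (br x y) = table c11 c12 c21 c22 (f x) (f y)" for x y
    by (metis fg gf gr)
  ultimately show ?thesis unfolding isomorphic_algebras_def by auto
qed

section \<open>Bracket squares and the case of zero product\<close>

lemma br_self_br_self: "br x (br x x) = 0"
  using right_leibniz[of x x x] by simp

lemma br_br_self_self: "br (br x x) x = 0"
  using left_leibniz[of x x x] by simp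

text \<open>Bracketing the assumption with \<open>x\<close> gives
  \<open>scale c (br x x) = 0\<close>, and \<open>c = 0\<close> also makes \<open>br x x\<close>
  vanish.\<close>

lemma br_self_collinear:
  assumes "br x x = scale c x"
  shows "br x x = 0"
  using br_self_br_self[of x] assms by (auto simp: br_simps)

lemma isomorphic_zero_mul:
  assumes m: "\<And>x y. mul x y = 0" and nz: "br a b \<noteq> 0"
  shows "isomorphic_algebras scale (mul, br) (*s) T1 \<or>
         isomorphic_algebras scale (mul, br) (*s) T2"
proof (cases "\<exists>x. br x x \<noteq> 0")
  case True
  then obtain x where g: "br x x \<noteq> 0" by blast
  have b: "basis_pair x (br x x)"
  proof (rule basis_pair_noncollinear)
    show "x \<noteq> 0" using g by (auto simp: br_simps)
    show "br x x \<noteq> scale c x" for c using br_self_collinear g by blast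
  qed
  \<comment> \<open>Both terms on the right of this Leibniz instance contain
    \<open>br x (br x x)\<close>.\<close>
  have "br (br x x) (br x x) = 0"
    using right_leibniz[of x x "br x x"] by (simp add: br_self_br_self br_simps)
  then have "isomorphic_algebras scale (mul, br) (*s) T1"
    unfolding T1_def
    by (intro isomorphic_tableI[OF b]) (simp_all add: m br_self_br_self br_br_self_self)
  then show ?thesis ..
next
  case False
  then have alt: "br x x = 0" for x by blast
  have anti: "br x y = - br y x" for x y
  proof -
    have "br x y + br y x = 0"
      using alt[of "x + y"] unfolding br_simps by (simp add: alt add.commute)
    then show ?thesis by (simp add: eq_neg_iff_add_eq_0)
  qed
  let ?v = "br a b"
  have ab: "basis_pair a b"
  proof (rule basis_pair_noncollinear)
    show "a \<noteq> 0" "b \<noteq> scale c a" for c using nz by (auto simp: br_simps alt)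
  qed
  \<comment> \<open>An alternating bilinear map on a plane is the determinant of the coordinates
    times its value on a basis.\<close>
  have multiple: "\<exists>c. br x y = scale c ?v" for x y
  proof -
    obtain p q where x: "x = scale p a + scale q b" using basis_pair_coords[OF ab] .
    obtain r s where y: "y = scale r a + scale s b" using basis_pair_coords[OF ab] .
    have "br x y = scale (p * s - q * r) ?v"
      unfolding x y by (simp add: br_simps alt anti[of b a] algebra_simps)
    then show ?thesis ..
  qed
  obtain w where vw: "basis_pair ?v w" using basis_pair_extend[OF nz] .
  obtain c where c: "br w ?v = scale c ?v" using multiple by blast
  \<comment> \<open>Otherwise the alternating bracket vanishes on the basis \<open>?v, w\<close>,
    hence everywhere, against \<open>nz\<close>.\<close>
  have "c \<noteq> 0"
  proof
    assume "c = 0"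
    then have z: "br w ?v = 0" "br ?v w = 0" using c anti[of ?v w] by simp_all
    obtain p q where a: "a = scale p ?v + scale q w" using basis_pair_coords[OF vw] .
    obtain r s where b: "b = scale r ?v + scale s w" using basis_pair_coords[OF vw] .
    have "br (scale p ?v + scale q w) (scale r ?v + scale s w) = 0"
      by (simp add: br_simps alt z)
    then show False using nz a b by metis
  qed
  let ?u = "scale (1 / c) w"
  have uv: "basis_pair ?u ?v"
  proof (rule basis_pairI)
    fix p q assume "scale p ?u + scale q ?v = 0"
    then show "p = 0 \<and> q = 0"
      using basis_pair_coeffs_0[OF vw, of q "p * (1 / c)"] \<open>c \<noteq> 0\<close> by (simp add: add.commute)
  qed
  have 1: "br ?u ?v = ?v" using c \<open>c \<noteq> 0\<close> by (simp add: br_simps)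
  have 2: "br ?v ?u = - ?v" using anti[of ?v ?u] 1 by simp
  have "isomorphic_algebras scale (mul, br) (*s) T2"
    unfolding T2_def by (intro isomorphic_tableI[OF uv]) (simp_all add: m alt 1 2)
  then show ?thesis ..
qed

section \<open>Brackets compatible with a given nonzero product\<close>

lemma scale_2_eq_self: "scale 2 w = w + w"
  using scale_left_distrib[of 1 1 w] by simp

text \<open>Multiplication by an idempotent is a projection, so 1/2 is not an eigenvalue.\<close>

lemma half_eigenvector:
  assumes "mul e e = e" and "scale 2 (mul w e) = w"
  shows "w = 0"
proof -
  have w: "w = mul w e + mul w e" using assms(2) by (simp add: scale_2_eq_self)
  have "mul (mul w e) e = mul w e" by (simp add: mul_assoc assms(1))
  then have "mul w e = mul w e + mul w e" by (metis w mul_simps(1))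
  then show ?thesis using w by simp
qed

text \<open>The bracket must vanish. By the transposed rule with \<open>z = u\<close>,
  multiplication by \<open>u\<close> halves \<open>br u v\<close> and \<open>br v u\<close>, fixes
  \<open>br u u\<close> and kills \<open>br v v\<close>. The last two are thus multiples of
  \<open>u\<close> and \<open>v\<close>, and \<open>br_self_collinear\<close> applies.\<close>

lemma isomorphic_orthogonal_product:
  assumes b: "basis_pair u v" and m: "mul u u = u" "mul u v = 0" "mul v v = scale q v"
  shows "isomorphic_algebras scale (mul, br) (*s) T3 \<or>
         isomorphic_algebras scale (mul, br) (*s) T6"
proof -
  have vu: "mul v u = 0" using m(2) by (simp add: mul_commute)
  have coords: "\<exists>c d. w = scale c u + scale d v \<and> mul w u = scale c u" for w
  proof -
    obtain c d where "w = scale c u + scale d v" using basis_pair_coords[OF b] .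
    then show ?thesis by (auto simp: mul_simps m vu)
  qed
  have uv: "br u v = 0" "br v u = 0"
    using half_eigenvector[OF m(1)] transposed_leibniz[of u v u] transposed_leibniz[of v u u]
    by (simp_all add: m vu br_simps)
  have uu: "br u u = 0"
  proof -
    obtain c d where w: "br u u = scale c u + scale d v" "mul (br u u) u = scale c u"
      using coords by blast
    have "scale 2 (mul (br u u) u) = scale 2 (br u u)"
      using transposed_leibniz[of u u u] by (simp add: m scale_2_eq_self)
    then have "br u u = scale c u" using w(2) by (metis scale_cancel_left zero_neq_numeral)
    then show ?thesis by (rule br_self_collinear)
  qed
  have vv: "br v v = 0"
  proof -
    obtain c d where w: "br v v = scale c u + scale d v" "mul (br v v) u = scale c u"
      using coords by blast
    have "scale 2 (mul (br v v) u) = 0"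
      using transposed_leibniz[of v v u] by (simp add: vu br_simps)
    then have "br v v = scale d v" using w by simp
    then show ?thesis by (rule br_self_collinear)
  qed
  show ?thesis
  proof (cases "q = 0")
    case True
    then have "isomorphic_algebras scale (mul, br) (*s) T6"
      unfolding T6_def by (intro isomorphic_tableI[OF b]) (simp_all add: m uu uv vv)
    then show ?thesis ..
  next
    case False
    have b': "basis_pair u (scale (1 / q) v)"
      using basis_pair_scale[OF b, of 1 "1 / q"] False by simp
    have "isomorphic_algebras scale (mul, br) (*s) T3"
      unfolding T3_def using False
      by (intro isomorphic_tableI[OF b']) (simp_all add: m uu uv vv mul_simps br_simps)
    then show ?thesis ..
  qed
qed

text \<open>The unital product uses this with \<open>z = v\<close>, the nilpotent one with \<open>z = u\<close>.\<close>

lemma br_nilpotent_multiplication: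
  assumes b: "basis_pair u v" and m: "mul u z = v" "mul v z = 0"
  obtains a c where "br u u = scale a v" "br u v = scale c v" "br v u = - scale c v"
    "br v v = 0" "a = 0 \<or> c = 0"
proof -
  obtain a1 a2 where uu: "br u u = scale a1 u + scale a2 v" using basis_pair_coords[OF b] .
  obtain b1 b2 where uv: "br u v = scale b1 u + scale b2 v" using basis_pair_coords[OF b] .
  obtain c1 c2 where vu: "br v u = scale c1 u + scale c2 v" using basis_pair_coords[OF b] .
  \<comment> \<open>Multiplication by \<open>z\<close> sends a vector to its
    \<open>u\<close>-coordinate times \<open>v\<close>, so the transposed rule with this
    \<open>z\<close> yields equations for \<open>a1\<close>, \<open>b1\<close>,
    \<open>c1\<close>.\<close>
  have 1: "scale (2 * b1) v = br v v"
    using transposed_leibniz[of u v z] by (simp add: m uv mul_simps br_simps)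
  have 2: "scale (2 * c1) v = br v v"
    using transposed_leibniz[of v u z] by (simp add: m vu mul_simps br_simps)
  have "scale (2 * a1) v = br v u + br u v"
    using transposed_leibniz[of u u z] by (simp add: m uu mul_simps br_simps)
  then have "scale 0 u + scale (2 * a1) v = scale (b1 + c1) u + scale (b2 + c2) v"
    by (simp add: uv vu algebra_simps)
  from basis_pair_coeffs_eq[OF b this] have 3: "b1 + c1 = 0" "b2 + c2 = 2 * a1" by auto
  have "scale 0 u + scale (2 * b1) v = scale 0 u + scale (2 * c1) v" using 1 2 by simp
  from basis_pair_coeffs_eq[OF b this] 3(1) have b1: "b1 = 0" and c1: "c1 = 0" by auto
  have vv: "br v v = 0" using 1 b1 by simp
  \<comment> \<open>Expanding \<open>br u (br u u) = 0\<close>: the \<open>u\<close>-coefficient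
    forces \<open>a1 = 0\<close>, and the other one then leaves \<open>a2 * b2 = 0\<close>.\<close>
  have "scale (a1 * a1) u + scale (a1 * a2 + a2 * b2) v = 0"
    using br_self_br_self[of u] by (simp add: uu uv br_simps b1 algebra_simps)
  from basis_pair_coeffs_0[OF b this] have a: "a1 = 0" "a2 = 0 \<or> b2 = 0"
    by (auto simp: algebra_simps)
  have "c2 = - b2" using 3(2) a(1) by (simp add: eq_neg_iff_add_eq_0 add.commute)
  show thesis
    by (rule that[of a2 b2]) (use uu uv vu vv a b1 c1 \<open>c2 = - b2\<close> in simp_all)
qed

lemma isomorphic_dual_numbers:
  assumes b: "basis_pair u v" and m: "mul u u = u" "mul u v = v" "mul v v = 0"
  shows "isomorphic_algebras scale (mul, br) (*s) T4 \<or>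
         (\<exists>\<alpha>. isomorphic_algebras scale (mul, br) (*s) (T5 \<alpha>))"
proof -
  obtain a c where r: "br u u = scale a v" "br u v = scale c v" "br v u = - scale c v"
    "br v v = 0" "a = 0 \<or> c = 0"
    using br_nilpotent_multiplication[OF b m(2,3)] .
  show ?thesis
  proof (cases "a = 0")
    case True
    then have "isomorphic_algebras scale (mul, br) (*s) (T5 c)"
      unfolding T5_def by (intro isomorphic_tableI[OF b]) (simp_all add: m r)
    then show ?thesis by blast
  next
    case False
    then have "c = 0" using r(5) by simp
    \<comment> \<open>Replacing \<open>v\<close> by \<open>br u u\<close> preserves the product
      table, as \<open>u\<close> is a unit and \<open>v\<close> squares to zero.\<close>
    have b': "basis_pair u (scale a v)"
      using basis_pair_scale[OF b, of 1 a] False by simp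
    have "isomorphic_algebras scale (mul, br) (*s) T4"
      unfolding T4_def using \<open>c = 0\<close>
      by (intro isomorphic_tableI[OF b']) (simp_all add: m r mul_simps br_simps)
    then show ?thesis ..
  qed
qed

lemma isomorphic_nilpotent_product:
  assumes b: "basis_pair u v" and m: "mul u u = v" "mul u v = 0"
  shows "(\<exists>\<alpha>. isomorphic_algebras scale (mul, br) (*s) (T7 \<alpha>)) \<or>
         isomorphic_algebras scale (mul, br) (*s) T8"
proof -
  have vu: "mul v u = 0" using m(2) by (simp add: mul_commute)
  have vv: "mul v v = 0" using mul_assoc[of u u v] by (simp add: m mul_simps)
  obtain a c where r: "br u u = scale a v" "br u v = scale c v" "br v u = - scale c v"
    "br v v = 0" "a = 0 \<or> c = 0"
    using br_nilpotent_multiplication[OF b m(1) vu] .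
  show ?thesis
  proof (cases "c = 0")
    case True
    then have "isomorphic_algebras scale (mul, br) (*s) (T7 a)"
      unfolding T7_def by (intro isomorphic_tableI[OF b]) (simp_all add: m vv r)
    then show ?thesis by blast
  next
    case False
    then have "a = 0" using r(5) by simp
    \<comment> \<open>Scaling \<open>u\<close> by \<open>t\<close> scales its square
      \<open>v\<close> by \<open>t * t\<close> and the coefficient \<open>c\<close> by
      \<open>t\<close>, so \<open>t = 1 / c\<close> normalizes it to 1.\<close>
    have b': "basis_pair (scale (1 / c) u) (scale ((1 / c) * (1 / c)) v)"
      using basis_pair_scale[OF b] False by simp
    have "isomorphic_algebras scale (mul, br) (*s) T8"
      unfolding T8_def using \<open>a = 0\<close> False
      by (intro isomorphic_tableI[OF b']) (simp_all add: m vv r mul_simps br_simps)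
    then show ?thesis ..
  qed
qed

section \<open>Algebras with a nonzero idempotent\<close>

lemma isomorphic_idempotent:
  assumes e: "mul e e = e" "e \<noteq> 0"
  shows "isomorphic_algebras scale (mul, br) (*s) T3 \<or>
         isomorphic_algebras scale (mul, br) (*s) T4 \<or>
         (\<exists>\<alpha>. isomorphic_algebras scale (mul, br) (*s) (T5 \<alpha>)) \<or>
         isomorphic_algebras scale (mul, br) (*s) T6"
proof -
  obtain w where b: "basis_pair e w" using basis_pair_extend[OF e(2)] .
  obtain p q where ew: "mul e w = scale p e + scale q w" using basis_pair_coords[OF b] .
  have "mul e (mul e w) = mul e w" using mul_assoc[of e e w] e(1) by simp
  then have "scale (p + q * p) e + scale (q * q) w = scale p e + scale q w"
    by (simp add: ew mul_simps e(1) algebra_simps)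
  from basis_pair_coeffs_eq[OF b this] have pq: "q * p = 0" "q * q = q" by auto
  show ?thesis
  proof (cases "q = 0")
    case True
    \<comment> \<open>Subtracting the component \<open>scale p e\<close> moves \<open>w\<close> into
      the kernel of multiplication by \<open>e\<close>.\<close>
    let ?v = "w - scale p e"
    have bv: "basis_pair e ?v" using basis_pair_shear[OF b] .
    have ev: "mul e ?v = 0" using True by (simp add: mul_simps ew e(1))
    obtain r s where vv: "mul ?v ?v = scale r e + scale s ?v" using basis_pair_coords[OF bv] .
    have "mul e (mul ?v ?v) = 0" using mul_assoc[of e ?v ?v] ev by (simp add: mul_simps(5))
    then have "scale r e = 0" unfolding vv mul_simps(2,4) ev e(1) by simp
    then have "mul ?v ?v = scale s ?v" using vv by simp
    then show ?thesis using isomorphic_orthogonal_product[OF bv e(1) ev] by blast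
  next
    case False
    then have "q = 1" "p = 0" using pq by auto
    then have ew: "mul e w = w" using ew by simp
    then have we: "mul w e = w" by (simp add: mul_commute)
    obtain r s where ww: "mul w w = scale r e + scale s w" using basis_pair_coords[OF b] .
    \<comment> \<open>Here \<open>e\<close> is a unit. Completing the square in the quadratic
      equation \<open>ww\<close> removes its linear term.\<close>
    let ?v = "w - scale (s / 2) e"
    have bv: "basis_pair e ?v" using basis_pair_shear[OF b] .
    have ev: "mul e ?v = ?v" by (simp add: mul_simps ew e(1))
    define d where "d = r + s * s / 4"
    have "scale s w = scale (s / 2) w + scale (s / 2) w"
      by (simp flip: scale_left_distrib)
    then have vv: "mul ?v ?v = scale d e"
      unfolding d_def by (simp add: mul_simps ew we e(1) ww algebra_simps)
    show ?thesis
    proof (cases "d = 0")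
      case True
      then have "mul ?v ?v = 0" using vv by simp
      then show ?thesis using isomorphic_dual_numbers[OF bv e(1) ev] by blast
    next
      case False
      \<comment> \<open>A complex square root of \<open>d\<close> rescales \<open>?v\<close> to a
        square root of the unit \<open>e\<close>.\<close>
      define t where "t = csqrt d"
      have t: "t * t = d" "t \<noteq> 0"
        using False power2_csqrt[of d] by (auto simp: t_def power2_eq_square)
      define v where "v = scale (1 / t) ?v"
      have v: "mul v v = e" "mul e v = v" "mul v e = v"
        using False t vv ev mul_commute[of v e] by (simp_all add: v_def mul_simps(3,4))
      have "basis_pair e v"
        unfolding v_def using basis_pair_scale[OF bv, of 1 "1 / t"] t by simp
      \<comment> \<open>Since \<open>v\<close> squares to the unit, these are orthogonal
        idempotents. The factor in \<open>scale 1 g\<close> below matches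
        \<open>isomorphic_orthogonal_product\<close>.\<close>
      define f g where "f = scale (1 / 2) (e + v)" and "g = scale (1 / 2) (e - v)"
      have fg: "basis_pair f g"
      proof (rule basis_pairI)
        fix x y assume "scale x f + scale y g = 0"
        then have "scale (x / 2 + y / 2) e + scale (x / 2 - y / 2) v = 0"
          by (simp add: f_def g_def algebra_simps)
        from basis_pair_coeffs_0[OF \<open>basis_pair e v\<close> this] show "x = 0 \<and> y = 0"
          by (auto simp: field_simps)
      qed
      have half: "scale (1 / 4) x + scale (1 / 4) x = scale (1 / 2) x" for x
        by (simp flip: scale_left_distrib)
      have mfg: "mul f f = f" "mul f g = 0" "mul g g = scale 1 g"
        unfolding f_def g_def mul_simps v e(1) using half[of e] half[of v]
        by (simp_all add: mul_simps v e(1) algebra_simps)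
      show ?thesis using isomorphic_orthogonal_product[OF fg mfg] by blast
    qed
  qed
qed

section \<open>Finding an idempotent or a nilpotent generator\<close>

lemma exists_mul_self_nonzero:
  assumes "mul x y \<noteq> 0"
  shows "\<exists>z. mul z z \<noteq> 0"
proof (rule ccontr)
  assume "\<not> ?thesis"
  then have z: "mul z z = 0" for z by blast
  have "scale 2 (mul x y) = 0"
    using z[of "x + y"] unfolding mul_simps mul_commute[of y x]
    by (simp add: z scale_2_eq_self)
  then show False using assms by simp
qed

text \<open>If \<open>x\<close> and its square are collinear, a multiple of \<open>x\<close> is
  idempotent. Otherwise they form a basis, and the coordinates \<open>p\<close>, \<open>q\<close> of
  the cube of \<open>x\<close> decide.\<close>

lemma idempotent_or_nilpotent_product:
  assumes x: "mul x x \<noteq> 0"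
  shows "(\<exists>e. mul e e = e \<and> e \<noteq> 0) \<or> basis_pair x (mul x x) \<and> mul x (mul x x) = 0"
proof (cases "\<exists>c. mul x x = scale c x")
  case True
  then obtain c where c: "mul x x = scale c x" by blast
  have "c \<noteq> 0" "x \<noteq> 0" using x c by auto
  then have "mul (scale (1 / c) x) (scale (1 / c) x) = scale (1 / c) x" "scale (1 / c) x \<noteq> 0"
    by (simp_all add: mul_simps c)
  then show ?thesis by blast
next
  case False
  define u where "u = mul x x"
  have b: "basis_pair x u"
    unfolding u_def using False x by (intro basis_pair_noncollinear) (auto simp: mul_simps)
  obtain p q where xu: "mul x u = scale p x + scale q u" using basis_pair_coords[OF b] .
  have ux: "mul u x = mul x u" by (rule mul_commute)
  have uu: "mul u u = mul x (mul x u)" using mul_assoc[of x x u] by (simp add: u_def)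
  consider "p \<noteq> 0" | "p = 0" "q \<noteq> 0" | "p = 0" "q = 0" by blast
  then show ?thesis
  proof cases
    case 1
    \<comment> \<open>Solving the cubic relation for \<open>scale p x\<close> shows that this
      \<open>e\<close> fixes \<open>x\<close>. By associativity it fixes \<open>u\<close>, hence
      itself.\<close>
    define e where "e = scale (1 / p) (u - scale q x)"
    have ex: "mul e x = x"
      using 1 by (simp add: e_def mul_simps ux xu flip: u_def)
    then have "mul e u = u" unfolding u_def by (metis mul_assoc)
    then have "mul e (scale (1 / p) (u - scale q x)) = scale (1 / p) (u - scale q x)"
      using ex by (simp add: mul_simps)
    then have "mul e e = e" by (simp flip: e_def)
    moreover have "e \<noteq> 0" using ex basis_pair_nonzero[OF b] by (auto simp: mul_simps)
    ultimately show ?thesis by blast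
  next
    case 2
    \<comment> \<open>With \<open>p = 0\<close> the cube is \<open>scale q u\<close>; one more
      multiplication by \<open>x\<close> gives the fourth power, which is
      \<open>mul u u\<close>.\<close>
    have "mul u u = scale (q * q) u" using 2 by (simp add: uu xu mul_simps)
    then have "mul (scale (1 / (q * q)) u) (scale (1 / (q * q)) u) = scale (1 / (q * q)) u"
      using 2 by (simp add: mul_simps)
    moreover have "scale (1 / (q * q)) u \<noteq> 0" using 2 basis_pair_nonzero[OF b] by simp
    ultimately show ?thesis by blast
  next
    case 3
    then show ?thesis using b xu by (simp add: u_def)
  qed
qed

end

theorem theorem24:
  fixes scale :: "complex \<Rightarrow> 'a::ab_group_add \<Rightarrow> 'a"
    and mul br :: "'a \<Rightarrow> 'a \<Rightarrow> 'a"
  assumes "transposed_leibniz_poisson scale mul br"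
    and "vector_space.dim scale (UNIV :: 'a set) = 2"
    and "(\<exists>x y. mul x y \<noteq> 0) \<or> (\<exists>x y. br x y \<noteq> 0)"
  shows "isomorphic_algebras scale (mul, br) (*s) T1 \<or>
         isomorphic_algebras scale (mul, br) (*s) T2 \<or>
         isomorphic_algebras scale (mul, br) (*s) T3 \<or>
         isomorphic_algebras scale (mul, br) (*s) T4 \<or>
         (\<exists>\<alpha>. isomorphic_algebras scale (mul, br) (*s) (T5 \<alpha>)) \<or>
         isomorphic_algebras scale (mul, br) (*s) T6 \<or>
         (\<exists>\<alpha>. isomorphic_algebras scale (mul, br) (*s) (T7 \<alpha>)) \<or>
         isomorphic_algebras scale (mul, br) (*s) T8"
proof -
  interpret transposed_leibniz_poisson_plane scale mul br
    using assms(1,2)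
    by (simp add: transposed_leibniz_poisson_plane_def plane_def plane_axioms_def
        transposed_leibniz_poisson_def complex_bilinear_def)
  show ?thesis
  proof (cases "\<exists>x y. mul x y \<noteq> 0")
    case True
    then obtain x where "mul x x \<noteq> 0" using exists_mul_self_nonzero by blast
    from idempotent_or_nilpotent_product[OF this] show ?thesis
      using isomorphic_idempotent isomorphic_nilpotent_product by blast
  next
    case False
    then show ?thesis using assms(3) isomorphic_zero_mul by blast
  qed
qed

end
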